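(* A purely inseparable extension $K/k$ is absolutely $lq$-finite if and only if every decreasing sequence of subextensions of $K/k$ (that is, every decreasing sequence $(F_i)_{i\ge1}$ of intermediate fields $k\subseteq F_i\subseteq K$) is stationary.
   Context: All fields are commutative of characteristic $p>0$. A purely inseparable extension $K/L$ is $lq$-finite if for every $n\ge 1$ the field $L^{p^{-n}}\cap K=\{x\in K:x^{p^n}\in L\}$ is a finite extension of $L$. A purely inseparable extension $K/k$ is absolutely $lq$-finite if $K/L$ is $lq$-finite for every intermediate field $k\subseteq L\subseteq K$; equivalently, if $L/k(L^p)$ is finite for every intermediate field $L$ of $K/k$. *)

theory Defs
  imports "HOL-Algebra.Algebra"
begin

definition has_characteristic :: "('a, 'b) ring_scheme \<Rightarrow> nat \<Rightarrow> bool"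
  where "has_characteristic R p \<longleftrightarrow>
    (\<forall>n::nat. add_pow R n \<one>\<^bsub>R\<^esub> = \<zero>\<^bsub>R\<^esub> \<longleftrightarrow> p dvd n)"

text \<open>An extension \<open>K/L\<close> is given by the field \<open>K\<close> (a ring record) and a subset \<open>L\<close> of its
  carrier with \<open>subfield L K\<close>; intermediate fields are likewise subsets of \<open>carrier K\<close>.
  The parameter \<open>p\<close> is always the characteristic of \<open>K\<close>.\<close>

definition intermediate_field :: "'a set \<Rightarrow> ('a, 'b) ring_scheme \<Rightarrow> 'a set \<Rightarrow> bool"
  where "intermediate_field k K L \<longleftrightarrow> subfield L K \<and> k \<subseteq> L"

definition purely_inseparable :: "nat \<Rightarrow> 'a set \<Rightarrow> ('a, 'b) ring_scheme \<Rightarrow> bool"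
  where "purely_inseparable p L K \<longleftrightarrow>
    (\<forall>x\<in>carrier K. \<exists>n::nat. x [^]\<^bsub>K\<^esub> (p ^ n) \<in> L)"

text \<open>The field L^(p^(-n)) intersected with K.\<close>

definition frobenius_roots :: "nat \<Rightarrow> nat \<Rightarrow> 'a set \<Rightarrow> ('a, 'b) ring_scheme \<Rightarrow> 'a set"
  where "frobenius_roots p n L K = {x \<in> carrier K. x [^]\<^bsub>K\<^esub> (p ^ n) \<in> L}"

text \<open>The next two notions are meant for purely inseparable \<open>K/L\<close> and \<open>K/k\<close>; this standing
  hypothesis is not repeated in the definitions.\<close>

definition lq_finite :: "nat \<Rightarrow> 'a set \<Rightarrow> ('a, 'b) ring_scheme \<Rightarrow> bool"
  where "lq_finite p L K \<longleftrightarrow>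
    (\<forall>n\<ge>1. ring.finite_dimension K L (frobenius_roots p n L K))"

definition absolutely_lq_finite :: "nat \<Rightarrow> 'a set \<Rightarrow> ('a, 'b) ring_scheme \<Rightarrow> bool"
  where "absolutely_lq_finite p k K \<longleftrightarrow>
    (\<forall>L. intermediate_field k K L \<longrightarrow> lq_finite p L K)"

end

theory Submission
  imports Defs
begin

text \<open>
  Write \<open>E\<^sup>1\<close> for the field of elements of \<open>K\<close> whose \<open>p\<close>-th power lies in \<open>E\<close>.

  Absolute lq-finiteness gives stationarity by looking at the intersection \<open>D\<close> of the
  sequence. As \<open>D\<^sup>1\<close> is finite over \<open>D\<close>, the decreasing \<open>D\<close>-subspaces \<open>F\<^sub>i \<inter> D\<^sup>1\<close>
  are eventually constant, hence eventually equal to their intersection \<open>D\<close>. An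
  \<open>F\<^sub>N\<close> with \<open>F\<^sub>N \<inter> D\<^sup>1 = D\<close> must be \<open>D\<close> itself, because the last of the powers
  \<open>y, y\<^sup>p, y\<^bsup>p\<^sup>2\<^esup>, \<dots>\<close> outside \<open>D\<close> of an element \<open>y\<close> of \<open>F\<^sub>N\<close> would lie in \<open>D\<^sup>1\<close>
  (\<open>decreasing_subfields_stationary\<close>).

  Conversely, iterating the passage from \<open>L\<close> to \<open>L\<^sup>1\<close> and using that degrees multiply in
  towers, it is enough that \<open>L\<^sup>1\<close> is finite over \<open>L\<close>. The descending chain condition
  provides a minimal field \<open>C\<close> between \<open>L\<close> and \<open>L\<^sup>1\<close> over which \<open>L\<^sup>1\<close> is finite. If \<open>C\<close>
  contained some \<open>x\<close> outside \<open>L\<close>, one could take a subfield \<open>E\<close> of \<open>C\<close> maximal among those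
  that contain \<open>L\<close> and avoid \<open>x\<close>. Every \<open>c\<close> in \<open>C\<close> outside \<open>E\<close> then has
  \<open>x \<in> E(c)\<close>, and the exchange property \<open>pth_root_exchange\<close> yields \<open>E(c) = E(x)\<close>. So
  \<open>C = E(x)\<close> is finite over the strictly smaller field \<open>E\<close>, against the minimality of \<open>C\<close>
  (\<open>finite_pth_roots\<close>).

  The exchange property holds because \<open>E(x)\<close> has degree exactly \<open>p\<close> over \<open>E\<close> as soon as
  \<open>x\<^sup>p \<in> E\<close> and \<open>x \<notin> E\<close> (\<open>degree_Irr_pth_root\<close>). The minimal polynomial divides
  \<open>X\<^sup>p - x\<^sup>p = (X - x)\<^sup>p\<close>, hence is \<open>(X - x)\<^sup>d\<close> for some \<open>d\<close> with \<open>1 \<le> d \<le> p\<close>; its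
  constant term shows \<open>x\<^sup>d \<in> E\<close>, and for \<open>d < p\<close> this, together with \<open>x\<^sup>p \<in> E\<close>,
  would force \<open>x \<in> E\<close>.
\<close>

section \<open>Powers in commutative rings and domains\<close>

lemma (in cring) binomial:
  assumes a: "a \<in> carrier R" and b: "b \<in> carrier R"
  shows "(a \<oplus> b) [^] (n::nat) = (\<Oplus>i\<in>{..n}. add_pow R (n choose i) (a [^] i \<otimes> b [^] (n - i)))"
proof (induction n)
  case 0
  then show ?case by simp
next
  case (Suc n)
  define T where "T i = a [^] i \<otimes> b [^] (Suc n - i)" for i
  define S where "S = (\<lambda>i. add_pow R (n choose i) (a [^] i \<otimes> b [^] (n - i)))"
  have T [simp]: "T i \<in> carrier R" for i
    unfolding T_def using a b by simp
  have S [simp]: "S i \<in> carrier R" for i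
    unfolding S_def using a b by simp
  have shift: "a \<otimes> S i = add_pow R (n choose i) (T (Suc i))" for i
  proof -
    have "a \<otimes> (a [^] i \<otimes> b [^] (n - i)) = T (Suc i)"
      unfolding T_def using a b by (simp add: m_ac)
    then show ?thesis
      unfolding S_def using a b by (simp add: add_pow_rdistr)
  qed
  have stay: "b \<otimes> S i = add_pow R (n choose i) (T i)" if "i \<le> n" for i
  proof -
    have "b \<otimes> (a [^] i \<otimes> b [^] (n - i)) = T i"
      unfolding T_def using a b that by (simp add: Suc_diff_le m_ac)
    then show ?thesis
      unfolding S_def using a b by (simp add: add_pow_rdistr)
  qed
  \<comment> \<open>The summand with index \<open>n + 1\<close> vanishes; it aligns the sum for Pascal's rule.\<close>
  have pad: "(\<Oplus>i\<in>{..n}. add_pow R (n choose i) (T i))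
      = (\<Oplus>i\<in>{..n}. add_pow R (n choose Suc i) (T (Suc i))) \<oplus> T 0"
  proof -
    have "(\<Oplus>i\<in>{..n}. add_pow R (n choose i) (T i)) = (\<Oplus>i\<in>{..Suc n}. add_pow R (n choose i) (T i))"
      by (subst finsum_Suc) (auto simp: binomial_eq_0)
    also have "\<dots> = (\<Oplus>i\<in>{..n}. add_pow R (n choose Suc i) (T (Suc i))) \<oplus> T 0"
      by (subst finsum_Suc2) auto
    finally show ?thesis .
  qed
  have "(a \<oplus> b) [^] Suc n = (a \<oplus> b) \<otimes> (\<Oplus>i\<in>{..n}. S i)"
    using Suc[folded S_def] a b by (simp add: m_comm)
  also have "\<dots> = a \<otimes> (\<Oplus>i\<in>{..n}. S i) \<oplus> b \<otimes> (\<Oplus>i\<in>{..n}. S i)"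
    using a b by (simp add: l_distr)
  also have "a \<otimes> (\<Oplus>i\<in>{..n}. S i) = (\<Oplus>i\<in>{..n}. add_pow R (n choose i) (T (Suc i)))"
    using a by (simp add: finsum_rdistr shift)
  also have "b \<otimes> (\<Oplus>i\<in>{..n}. S i) = (\<Oplus>i\<in>{..n}. add_pow R (n choose i) (T i))"
    using b by (subst finsum_rdistr) (auto intro!: finsum_cong' simp: stay)
  also have "(\<Oplus>i\<in>{..n}. add_pow R (n choose i) (T (Suc i))) \<oplus> \<dots>
      = (\<Oplus>i\<in>{..n}. add_pow R (n choose i) (T (Suc i)) \<oplus> add_pow R (n choose Suc i) (T (Suc i))) \<oplus> T 0"
    unfolding pad by (simp add: finsum_addf a_assoc Pi_def)
  also have "\<dots> = (\<Oplus>i\<in>{..n}. add_pow R (Suc n choose Suc i) (T (Suc i))) \<oplus> T 0"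
    by (simp add: add.nat_pow_mult)
  also have "\<dots> = (\<Oplus>i\<in>{..Suc n}. add_pow R (Suc n choose i) (T i))"
    by (subst finsum_Suc2) auto
  finally show ?case unfolding T_def .
qed

lemma (in cring) freshmans_dream:
  assumes p: "Factorial_Ring.prime (p::nat)" and char: "add_pow R p \<one> = \<zero>"
    and a: "a \<in> carrier R" and b: "b \<in> carrier R"
  shows "(a \<oplus> b) [^] p = a [^] p \<oplus> b [^] p"
proof -
  have kill: "add_pow R m z = \<zero>" if "p dvd m" "z \<in> carrier R" for m :: nat and z
  proof -
    from that(1) obtain k where k: "m = p * k" ..
    have "add_pow R m \<one> = add_pow R k (add_pow R p \<one>)"
      unfolding k by (simp add: add.nat_pow_pow)
    then have "add_pow R m \<one> = \<zero>"
      by (simp add: char)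
    then show ?thesis
      using add_pow_ldistr[of \<one> z m] that(2) by simp
  qed
  obtain q where q: "p = Suc (Suc q)"
    using prime_ge_2_nat[OF p] by (metis le_add_diff_inverse add_2_eq_Suc)
  define T where "T i = add_pow R (p choose i) (a [^] i \<otimes> b [^] (p - i))" for i
  have T [simp]: "T i \<in> carrier R" for i
    unfolding T_def using a b by simp
  have mid: "T (Suc i) = \<zero>" if "i \<le> q" for i
    unfolding T_def using a b that q
    by (intro kill dvd_choose_prime[OF _ _ _ p]) auto
  have "(a \<oplus> b) [^] p = (\<Oplus>i\<in>{..Suc (Suc q)}. T i)"
    unfolding T_def using binomial[OF a b, of p] q by simp
  also have "\<dots> = T (Suc (Suc q)) \<oplus> ((\<Oplus>i\<in>{..q}. T (Suc i)) \<oplus> T 0)"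
    by (subst finsum_Suc, simp, subst finsum_Suc2) auto
  also have "(\<Oplus>i\<in>{..q}. T (Suc i)) = \<zero>"
    using mid by (intro add.finprod_one_eqI) auto
  also have "T (Suc (Suc q)) = a [^] p"
    unfolding T_def q[symmetric] using a b by simp
  also have "T 0 = b [^] p"
    unfolding T_def using a b by simp
  finally show ?thesis using a b by simp
qed

text \<open>
  A prime dividing \<open>g \<otimes> h\<close> can be cancelled from one of the two factors, which lowers the
  exponent. This is the only part of unique factorization that the minimal polynomial of a
  \<open>p\<close>-th root requires.
\<close>

lemma (in domain) divisor_of_prime_power:
  assumes P: "P \<in> carrier R" "ring_prime P"
    and "g \<in> carrier R" "h \<in> carrier R" "g \<otimes> h = P [^] (n::nat)"
  shows "\<exists>u\<in>Units R. \<exists>d::nat. g = u \<otimes> P [^] d"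
  using assms(3-)
proof (induction n arbitrary: g h)
  case 0
  then have "g \<in> Units R"
    by (metis Units_one_closed nat_pow_0 unit_factor)
  with 0 show ?case
    by (metis nat_pow_0 r_one)
next
  case (Suc n)
  have eq: "g \<otimes> h = P \<otimes> P [^] n"
    using Suc.prems P by (simp add: m_comm)
  then have "P divides (g \<otimes> h)"
    using P by auto
  then consider "P divides h" | "P divides g"
    using ring_primeE(3)[OF P] Suc.prems unfolding prime_def by blast
  then show ?case
  proof cases
    case 1
    then obtain h' where h': "h' \<in> carrier R" "h = P \<otimes> h'" by (auto elim: dividesE)
    have "P \<otimes> (g \<otimes> h') = P \<otimes> P [^] n"
      using eq h' P Suc.prems by (simp add: m_lcomm)
    then have "g \<otimes> h' = P [^] n"
      using m_lcancel[of P "g \<otimes> h'" "P [^] n"] P Suc.prems h' ring_primeE(1)[OF P] by auto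
    then show ?thesis using Suc.IH[of g h'] Suc.prems h' by blast
  next
    case 2
    then obtain g' where g': "g' \<in> carrier R" "g = P \<otimes> g'" by (auto elim: dividesE)
    have "P \<otimes> (g' \<otimes> h) = P \<otimes> P [^] n"
      using eq g' P Suc.prems by (simp add: m_assoc)
    then have "g' \<otimes> h = P [^] n"
      using m_lcancel[of P "g' \<otimes> h" "P [^] n"] P Suc.prems g' ring_primeE(1)[OF P] by auto
    then obtain u d where "u \<in> Units R" "g' = u \<otimes> P [^] (d::nat)"
      using Suc.IH[of g' h] Suc.prems g' by blast
    then have "g = u \<otimes> P [^] Suc d"
      using g' P by (simp add: m_ac Units_closed)
    with \<open>u \<in> Units R\<close> show ?thesis by blast
  qed
qed



section \<open>Subfields and their chains\<close>

lemma (in field) subfieldI_closed: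
  assumes "E \<subseteq> carrier R" "\<one> \<in> E"
    and "\<And>x y. \<lbrakk> x \<in> E; y \<in> E \<rbrakk> \<Longrightarrow> x \<oplus> y \<in> E"
    and "\<And>x. x \<in> E \<Longrightarrow> \<ominus> x \<in> E"
    and "\<And>x y. \<lbrakk> x \<in> E; y \<in> E \<rbrakk> \<Longrightarrow> x \<otimes> y \<in> E"
    and "\<And>x. \<lbrakk> x \<in> E; x \<noteq> \<zero> \<rbrakk> \<Longrightarrow> inv x \<in> E"
  shows "subfield E R"
  using assms by (intro subfieldI' subringI) auto

lemma (in ring) subfield_pow_closed:
  assumes "subfield E R" "x \<in> E" shows "x [^] (n::nat) \<in> E"
  using subringE(3,6)[OF subfieldE(1)[OF assms(1)]] assms(2) by (induction n) auto

text \<open>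
  By Bezout, \<open>x\<close> is a quotient of a power of \<open>x\<^sup>m\<close> by a power of \<open>x\<^sup>n\<close>.
\<close>

lemma (in field) subfield_coprime_powers:
  assumes E: "subfield E R" and x: "x \<in> carrier R"
    and m: "x [^] (m::nat) \<in> E" and n: "x [^] (n::nat) \<in> E" and cop: "coprime m n"
  shows "x \<in> E"
proof (cases "x = \<zero> \<or> m = 0")
  case True
  then show ?thesis
  proof
    assume "m = 0" with cop n x show ?thesis by simp
  qed (use subringE(2)[OF subfieldE(1)[OF E]] in simp)
next
  case False
  then obtain a b where ab: "m * a = Suc (n * b)"
    using bezout_nat[of m n] cop by (auto simp: coprime_iff_gcd_eq_1)
  have "x [^] (n * b) \<otimes> x = x [^] (m * a)"
    using x by (simp add: ab)
  moreover have "x [^] (m * a) \<in> E" "x [^] (n * b) \<in> E"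
    using subfield_pow_closed[OF E m, of a] subfield_pow_closed[OF E n, of b] x
    by (simp_all add: nat_pow_pow)
  moreover have "x [^] (n * b) \<noteq> \<zero>"
    using False x by (metis field_Units Diff_iff Units_pow_closed singletonD insertI1)
  ultimately show ?thesis
    using subfield_m_inv_simprule[OF E, of "x [^] (n * b)" x] x by simp
qed

text \<open>
  From the first space of least dimension onwards, every inclusion is between spaces of equal
  finite dimension.
\<close>

lemma (in ring) decreasing_subspaces_stationary:
  assumes D: "subfield D R" and fin: "\<And>i. finite_dimension D (W i)" and dec: "decseq W"
  shows "\<exists>N. \<forall>i\<ge>N. W i = W N"
proof -
  define d where "d i = (dim over D) (W i)" for i
  have d: "dimension (d i) D (W i)" for i
    using finite_dimensionE[OF D fin] by (simp add: d_def)
  obtain N where N: "\<And>i. d N \<le> d i"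
    using ex_has_least_nat[of "\<lambda>_. True" 0 d] by auto
  have "W i = W N" if i: "i \<ge> N" for i
  proof -
    have sub: "W i \<subseteq> W N"
      using decseqD[OF dec i] .
    obtain B where B: "independent D B" "length B = d i" "Span D B = W i"
      using exists_base[OF D d] by blast
    have "set B \<subseteq> W N"
      using Span_base_incl[OF D independent_in_carrier[OF B(1)]] B(3) sub by auto
    moreover from this have "d i \<le> d N"
      using independent_length_le_dimension[OF D d B(1)] B(2) by auto
    ultimately show ?thesis
      using independent_length_eq_dimension[OF D d B(1), of N] B N[of i] by simp
  qed
  then show ?thesis by blast
qed

lemma (in field) subfield_Inter:
  assumes "\<F> \<noteq> {}" "\<And>A. A \<in> \<F> \<Longrightarrow> subfield A R"
  shows "subfield (\<Inter>\<F>) R"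
proof (rule subfieldI')
  show "subring (\<Inter>\<F>) R"
    using assms by (intro subring_Inter) (auto dest: subfieldE(1))
  show "inv x \<in> \<Inter>\<F>" if "x \<in> \<Inter>\<F> - {\<zero>}" for x
    using that assms(2) subfield_m_inv(1) by blast
qed

lemma (in field) maximal_subfield_avoiding:
  assumes L: "subfield L R" and C: "subfield C R" "L \<subseteq> C" and x: "x \<notin> L"
  obtains E where "subfield E R" "L \<subseteq> E" "E \<subseteq> C" "x \<notin> E"
    and "\<And>E'. subfield E' R \<Longrightarrow> E \<subseteq> E' \<Longrightarrow> E' \<subseteq> C \<Longrightarrow> x \<notin> E' \<Longrightarrow> E' = E"
proof -
  define \<A> where "\<A> = {E. subfield E R \<and> L \<subseteq> E \<and> E \<subseteq> C \<and> x \<notin> E}"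
  have "\<exists>E\<in>\<A>. \<forall>E'\<in>\<A>. E \<subseteq> E' \<longrightarrow> E' = E"
  proof (rule subset_Zorn_nonempty)
    show "\<A> \<noteq> {}"
      using assms by (auto simp: \<A>_def)
    fix \<C> assume ne: "\<C> \<noteq> {}" and "subset.chain \<A> \<C>"
    then have sub: "\<And>A. A \<in> \<C> \<Longrightarrow> A \<in> \<A>"
      and tot: "\<And>A B. A \<in> \<C> \<Longrightarrow> B \<in> \<C> \<Longrightarrow> A \<subseteq> B \<or> B \<subseteq> A"
      by (auto simp: subset_chain_def)
    have sf: "subfield A R" if "A \<in> \<C>" for A
      using sub[OF that] by (simp add: \<A>_def)
    note sr = subringE[OF subfieldE(1)[OF sf]]
    have common: "\<exists>A\<in>\<C>. a \<in> A \<and> b \<in> A" if "a \<in> \<Union>\<C>" "b \<in> \<Union>\<C>" for a b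
      using that tot by blast
    have "subfield (\<Union>\<C>) R"
    proof (rule subfieldI_closed)
      show "\<Union>\<C> \<subseteq> carrier R" using sr(1) by blast
      show "\<one> \<in> \<Union>\<C>" using sr(3) ne by blast
      show "a \<oplus> b \<in> \<Union>\<C>" if "a \<in> \<Union>\<C>" "b \<in> \<Union>\<C>" for a b
        using common[OF that] sr(7) by blast
      show "a \<otimes> b \<in> \<Union>\<C>" if "a \<in> \<Union>\<C>" "b \<in> \<Union>\<C>" for a b
        using common[OF that] sr(6) by blast
      show "\<ominus> a \<in> \<Union>\<C>" if "a \<in> \<Union>\<C>" for a
        using that sr(5) by blast
      show "inv a \<in> \<Union>\<C>" if "a \<in> \<Union>\<C>" "a \<noteq> \<zero>" for a
        using that subfield_m_inv(1)[OF sf] by blast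
    qed
    then show "\<Union>\<C> \<in> \<A>"
      using ne sub by (auto simp: \<A>_def)
  qed
  then obtain E where E: "E \<in> \<A>" and max: "\<And>E'. E' \<in> \<A> \<Longrightarrow> E \<subseteq> E' \<Longrightarrow> E' = E"
    by blast
  show thesis
  proof (rule that)
    show "subfield E R" "L \<subseteq> E" "E \<subseteq> C" "x \<notin> E"
      using E by (auto simp: \<A>_def)
    show "E' = E" if "subfield E' R" "E \<subseteq> E'" "E' \<subseteq> C" "x \<notin> E'" for E'
      using max[of E'] that E by (auto simp: \<A>_def)
  qed
qed

section \<open>Adjoining p-th roots\<close>

locale char_p_field = field +
  fixes p :: nat
  assumes p_prime: "Factorial_Ring.prime p"
    and p_zero: "add_pow R p \<one> = \<zero>"
begin

lemma frobenius_minus: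
  assumes "x \<in> carrier R" shows "(\<ominus> x) [^] p = \<ominus> (x [^] p)"
proof -
  have "(\<ominus> x) [^] p \<oplus> x [^] p = (\<ominus> x \<oplus> x) [^] p"
    using freshmans_dream[OF p_prime p_zero, of "\<ominus> x" x] assms by simp
  also have "\<dots> = \<zero>"
    using assms prime_gt_0_nat[OF p_prime] by (simp add: l_neg nat_pow_zero)
  finally show ?thesis
    using assms by (simp add: minus_equality)
qed

lemma frobenius_subfield:
  assumes "subfield E R"
  shows "subfield (frobenius_roots p 1 E R) R"
proof (rule subfieldI_closed)
  note E = subringE[OF subfieldE(1)[OF assms]]
  show "x \<oplus> y \<in> frobenius_roots p 1 E R"
    if "x \<in> frobenius_roots p 1 E R" "y \<in> frobenius_roots p 1 E R" for x y
    using that E(7) freshmans_dream[OF p_prime p_zero, of x y] unfolding frobenius_roots_def by simp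
  show "\<ominus> x \<in> frobenius_roots p 1 E R" if "x \<in> frobenius_roots p 1 E R" for x
    using that E(5) unfolding frobenius_roots_def by (simp add: frobenius_minus)
  show "inv x \<in> frobenius_roots p 1 E R" if x: "x \<in> frobenius_roots p 1 E R" "x \<noteq> \<zero>" for x
  proof -
    have U: "x \<in> Units R" and xp: "x [^] p \<in> E"
      using x by (auto simp: field_Units frobenius_roots_def)
    then have "x [^] p \<in> E - {\<zero>}"
      using Units_pow_closed[OF U, of p] by (simp add: field_Units)
    moreover have "inv x [^] p = inv (x [^] p)"
      using U nat_pow_distrib[of x "inv x" p] comm_inv_char[of "x [^] p" "inv x [^] p"]
      by (simp add: Units_closed)
    ultimately show ?thesis
      using subfield_m_inv(1)[OF assms] U by (simp add: frobenius_roots_def)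
  qed
qed (use subringE[OF subfieldE(1)[OF assms]] in \<open>auto simp: frobenius_roots_def nat_pow_distrib\<close>)

lemma frobenius_roots_Suc:
  "frobenius_roots p (Suc n) E R = frobenius_roots p 1 (frobenius_roots p n E R) R"
  by (auto simp: frobenius_roots_def nat_pow_pow)

lemma frobenius_roots_0: "E \<subseteq> carrier R \<Longrightarrow> frobenius_roots p 0 E R = E"
  by (auto simp: frobenius_roots_def)


text \<open>
  The polynomial \<open>(X - x)\<^sup>p\<close> can be formed over \<open>R\<close>, where its divisors are visible, but by
  the freshman's dream its coefficients are in \<open>E\<close>, so that the minimal polynomial over \<open>E\<close>
  divides it.
\<close>

lemma degree_Irr_pth_root:
  assumes E: "subfield E R" and x: "x \<in> carrier R" "x [^] p \<in> E" "x \<notin> E"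
  shows "(algebraic over E) x" and "degree (Irr E x) = p"
proof -
  note E' = subfieldE(1)[OF E]
  interpret UP: domain "poly_ring R"
    using univ_poly_is_domain[OF carrier_is_subring] .
  interpret EX: domain "E[X]"
    using univ_poly_is_domain[OF E'] .
  have same_pow: "a [^]\<^bsub>E[X]\<^esub> (n::nat) = a [^]\<^bsub>poly_ring R\<^esub> n" for a n
    by (simp add: nat_pow_def univ_poly_one univ_poly_mult)
  \<comment> \<open>Working with \<open>P = X + y\<close>, where \<open>y = - x\<close>, keeps signs out of the powers.\<close>
  define y where "y = \<ominus> x"
  have y: "y \<in> carrier R" "y [^] p \<in> E"
    using x subringE(5)[OF E'] by (auto simp: y_def frobenius_minus)
  define P where "P = [\<one>, y]"
  have P: "P \<in> carrier (poly_ring R)" "P \<noteq> []" "degree P = 1"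
    using y by (auto simp: P_def univ_poly_carrier[symmetric] polynomial_def)
  have P_prime: "ring_prime\<^bsub>poly_ring R\<^esub> P"
    using degree_one_imp_pirreducible[OF carrier_is_subfield P(1,3)]
      pprime_iff_pirreducible[OF carrier_is_subfield P(1)] by simp
  define h where "h = P [^]\<^bsub>poly_ring R\<^esub> p"
  have hc: "ring_hom_ring R (poly_ring R) poly_of_const"
    using canonical_embedding_ring_hom[OF carrier_is_subring] by simp
  interpret hc: ring_hom_ring R "poly_ring R" poly_of_const
    using hc .
  have UP_char: "add_pow (poly_ring R) p \<one>\<^bsub>poly_ring R\<^esub> = \<zero>\<^bsub>poly_ring R\<^esub>"
  proof -
    have "add_pow (poly_ring R) n \<one>\<^bsub>poly_ring R\<^esub> = poly_of_const (add_pow R n \<one>)" for n :: nat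
      by (induction n) auto
    then show ?thesis
      by (simp add: p_zero)
  qed
  have X: "X \<in> carrier (E[X])" "X \<in> carrier (poly_ring R)"
    using var_closed(1) E' carrier_is_subring by blast+
  have P_sum: "P = X \<oplus>\<^bsub>poly_ring R\<^esub> poly_of_const y"
    using y by (auto simp: P_def var_def poly_of_const_def univ_poly_add)
  have "h = X [^]\<^bsub>poly_ring R\<^esub> p \<oplus>\<^bsub>poly_ring R\<^esub> poly_of_const y [^]\<^bsub>poly_ring R\<^esub> p"
    unfolding h_def P_sum
    by (rule UP.freshmans_dream[OF p_prime UP_char X(2)]) (use y in auto)
  also have "\<dots> = X [^]\<^bsub>E[X]\<^esub> p \<oplus>\<^bsub>E[X]\<^esub> poly_of_const (y [^] p)"
    using y by (simp add: hc.hom_nat_pow same_pow univ_poly_add)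
  finally have h_eq: "h = X [^]\<^bsub>E[X]\<^esub> p \<oplus>\<^bsub>E[X]\<^esub> poly_of_const (y [^] p)" .
  have "poly_of_const (y [^] p) \<in> carrier (E[X])"
    using ring_hom_closed[OF canonical_embedding_is_hom[OF E'], of "y [^] p"] y by simp
  then have h_in: "h \<in> carrier (E[X])"
    using X by (simp add: h_eq)
  have h_nz: "h \<noteq> []" and h_deg: "degree h = p"
    using polynomial_pow_not_zero[OF P(1,2)] polynomial_pow_degree[OF P(1), of p] P(3) by (simp_all add: h_def)
  interpret ev: ring_hom_ring "poly_ring R" R "\<lambda>q. eval q x"
    using eval_cring_hom[OF carrier_is_subring x(1)]
    by (simp add: ring_hom_cring_def ring_hom_ringI2 ring_hom_cring_axioms_def
        UP.ring_axioms ring_axioms)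
  have "eval P x = \<zero>"
    using x(1) by (simp add: P_def y_def r_neg)
  then have h_root: "eval h x = \<zero>"
    using P(1) prime_gt_0_nat[OF p_prime] by (simp add: h_def ev.hom_nat_pow nat_pow_zero)
  show alg: "(algebraic over E) x"
    using algebraicI[OF h_in h_nz h_root] .
  define g where "g = Irr E x"
  note Irr = IrrE[OF E x(1) alg, folded g_def]
  have g_dvd: "g pdivides h"
    using Irr_minimal[OF E x(1) alg h_in h_root] by (simp add: g_def)
  have g: "g \<in> carrier (poly_ring R)" "g \<noteq> []" "degree g \<ge> 1"
    using carrier_polynomial_shell[OF E' Irr(1)] pirreducibleE(1)[OF E' Irr(1,2)]
      pirreducible_degree[OF E Irr(1,2)] by auto
  obtain h' where h': "h' \<in> carrier (poly_ring R)" "g \<otimes>\<^bsub>poly_ring R\<^esub> h' = P [^]\<^bsub>poly_ring R\<^esub> p"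
    using g_dvd unfolding pdivides_def h_def by (auto elim: dividesE)
  obtain u d where u: "u \<in> Units (poly_ring R)"
      and g_pow: "g = u \<otimes>\<^bsub>poly_ring R\<^esub> P [^]\<^bsub>poly_ring R\<^esub> (d::nat)"
    using UP.divisor_of_prime_power[OF P(1) P_prime g(1) h'] by blast
  obtain c where c: "c \<in> carrier R" "c \<noteq> \<zero>" "u = [c]"
    using u univ_poly_carrier_units by auto
  define Q where "Q = P [^]\<^bsub>poly_ring R\<^esub> d"
  have lead: "lead_coeff (a \<otimes>\<^bsub>poly_ring R\<^esub> b) = lead_coeff a \<otimes> lead_coeff b"
    if "a \<in> carrier (poly_ring R)" "b \<in> carrier (poly_ring R)" "a \<noteq> []" "b \<noteq> []" for a b
    using that poly_mult_lead_coeff[OF carrier_is_subring, of a b]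
    by (simp add: univ_poly_carrier univ_poly_mult)
  have Q: "Q \<in> carrier (poly_ring R)" "Q \<noteq> []" "degree Q = d"
    using polynomial_pow_not_zero[OF P(1,2)] polynomial_pow_degree[OF P(1), of d] P(1,3) by (simp_all add: Q_def)
  have "lead_coeff (P [^]\<^bsub>poly_ring R\<^esub> n) = \<one>" for n :: nat
  proof (induction n)
    case (Suc n)
    then show ?case
      using lead[of "P [^]\<^bsub>poly_ring R\<^esub> n" P] P polynomial_pow_not_zero[OF P(1,2), of n]
      by (simp add: P_def)
  qed (simp add: univ_poly_one)
  then have "lead_coeff g = c"
    using lead[of u Q] u c Q UP.Units_closed[OF u] by (simp add: g_pow Q_def)
  then have "c = \<one>"
    using Irr(3) by simp
  then have "u = \<one>\<^bsub>poly_ring R\<^esub>"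
    using c by (simp add: univ_poly_one)
  then have gQ: "g = Q"
    using g_pow Q by (simp add: Q_def)
  have d: "1 \<le> d" "d \<le> p"
    using g(3) Q(3) gQ pdivides_imp_degree_le[OF E' Irr(1) h_in h_nz g_dvd] h_deg by auto
  interpret ev0: ring_hom_ring "poly_ring R" R "\<lambda>q. eval q \<zero>"
    using eval_cring_hom[OF carrier_is_subring zero_closed]
    by (simp add: ring_hom_cring_def ring_hom_ringI2 ring_hom_cring_axioms_def
        UP.ring_axioms ring_axioms)
  have "const_term g = y [^] d"
    using y P(1) by (simp add: gQ Q_def const_term_def ev0.hom_nat_pow) (simp add: P_def)
  then have yd: "y [^] d \<in> E"
    using const_term_simprules_shell(1)[OF E' Irr(1)] by simp
  have "y \<notin> E"
    using x subringE(5)[OF E'] by (metis y_def minus_minus)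
  then have "\<not> coprime d p"
    using subfield_coprime_powers[OF E y(1) yd y(2)] by blast
  then have "p dvd d"
    using prime_imp_coprime[OF p_prime, of d] by (auto simp: coprime_commute)
  then show "degree (Irr E x) = p"
    using d gQ Q(3) by (auto simp: g_def dest: dvd_imp_le)
qed

text \<open>
  Both extensions have degree \<open>p\<close> over \<open>E\<close> and one contains the other.
\<close>

lemma pth_root_exchange:
  assumes E: "subfield E R" and x: "x \<in> carrier R" "x [^] p \<in> E" "x \<notin> E"
    and c: "c \<in> carrier R" "c [^] p \<in> E" and mem: "x \<in> simple_extension E c"
  shows "simple_extension E x = simple_extension E c"
proof -
  note E' = subfieldE(1)[OF E]
  have "c \<notin> E"
    using mem simple_extension_subring_incl[OF E' subset_refl, of c] x(3) by blast
  then have dim_c: "dimension p E (simple_extension E c)"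
    using degree_Irr_pth_root[OF E c] dimension_simple_extension[OF E c(1)] by simp
  have dim_x: "dimension p E (simple_extension E x)"
    using degree_Irr_pth_root[OF E x] dimension_simple_extension[OF E x(1)] by simp
  obtain B where B: "independent E B" "length B = p" "Span E B = simple_extension E x"
    using exists_base[OF E dim_x] by blast
  have "simple_extension E x \<subseteq> simple_extension E c"
    using simple_extension_subring_incl[OF simple_extension_is_subring[OF E' c(1)]
        simple_extension_incl[OF subringE(1)[OF E'] c(1)] mem] .
  then have "set B \<subseteq> simple_extension E c"
    using Span_base_incl[OF E independent_in_carrier[OF B(1)]] B(3) by auto
  then show ?thesis
    using independent_length_eq_dimension[OF E dim_c B(1)] B by simp
qed


section \<open>Chain conditions and finiteness\<close>

lemma finite_pth_roots:
  assumes L: "subfield L R"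
    and dcc: "\<And>\<F>. \<F> \<noteq> {} \<Longrightarrow> \<forall>A\<in>\<F>. subfield A R \<and> L \<subseteq> A \<Longrightarrow>
      \<exists>C\<in>\<F>. \<forall>A\<in>\<F>. A \<subseteq> C \<longrightarrow> A = C"
  shows "finite_dimension L (frobenius_roots p 1 L R)"
proof -
  define M where "M = frobenius_roots p 1 L R"
  define \<F> where "\<F> = {C. subfield C R \<and> L \<subseteq> C \<and> C \<subseteq> M \<and> finite_dimension C M}"
  have M: "subfield M R"
    unfolding M_def by (rule frobenius_subfield[OF L])
  have "L \<subseteq> M"
    using subfield_pow_closed[OF L, of _ p] subringE(1)[OF subfieldE(1)[OF L]]
    by (auto simp: M_def frobenius_roots_def)
  then have "M \<in> \<F>"
    using M finite_dimensionI[OF dimension_one[OF M]] by (simp add: \<F>_def)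
  then have "\<exists>C\<in>\<F>. \<forall>A\<in>\<F>. A \<subseteq> C \<longrightarrow> A = C"
    by (intro dcc) (auto simp: \<F>_def)
  then obtain C where C: "C \<in> \<F>" "\<And>A. A \<in> \<F> \<Longrightarrow> A \<subseteq> C \<Longrightarrow> A = C"
    by blast
  then have C': "subfield C R" "L \<subseteq> C" "C \<subseteq> M" "finite_dimension C M"
    by (auto simp: \<F>_def)
  \<comment> \<open>Otherwise \<open>C\<close> would be finite over a strictly smaller member of the family.\<close>
  have "C = L"
  proof (rule ccontr)
    assume "C \<noteq> L"
    then obtain x where x: "x \<in> C" "x \<notin> L"
      using C'(2) by blast
    obtain E where E: "subfield E R" "L \<subseteq> E" "E \<subseteq> C" "x \<notin> E"
      and max: "\<And>E'. subfield E' R \<Longrightarrow> E \<subseteq> E' \<Longrightarrow> E' \<subseteq> C \<Longrightarrow> x \<notin> E' \<Longrightarrow> E' = E"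
      using maximal_subfield_avoiding[OF L C'(1,2) x(2)] by metis
    note E' = subfieldE(1)[OF E(1)]
    have root: "c \<in> carrier R" "c [^] p \<in> E" if "c \<in> C" for c
      using that C'(3) E(2) by (auto simp: M_def frobenius_roots_def)
    have "c \<in> simple_extension E x" if c: "c \<in> C" for c
    proof (cases "c \<in> E")
      case True
      then show ?thesis
        using simple_extension_incl[OF subringE(1)[OF E'] root(1)[OF x(1)]] by blast
    next
      case False
      have c_in: "c \<in> simple_extension E c"
        using simple_extension_mem[OF E' root(1)[OF c]] .
      have "subfield (simple_extension E c) R"
        using simple_extension_is_subfield[OF E(1) root(1)[OF c]]
          degree_Irr_pth_root(1)[OF E(1) root[OF c] False] by simp
      moreover have "E \<subseteq> simple_extension E c"
        using simple_extension_incl[OF subringE(1)[OF E'] root(1)[OF c]] .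
      moreover have "simple_extension E c \<subseteq> C"
        using simple_extension_subring_incl[OF subfieldE(1)[OF C'(1)] E(3) c] .
      ultimately have "x \<in> simple_extension E c"
        using max c_in False by blast
      then show ?thesis
        using pth_root_exchange[OF E(1) root[OF x(1)] E(4) root[OF c]] c_in by simp
    qed
    moreover have "simple_extension E x \<subseteq> C"
      using simple_extension_subring_incl[OF subfieldE(1)[OF C'(1)] E(3) x(1)] .
    ultimately have "C = simple_extension E x"
      by blast
    then have "finite_dimension E C"
      using finite_dimension_simple_extension[OF E(1) root(1)[OF x(1)]]
        degree_Irr_pth_root(1)[OF E(1) root[OF x(1)] E(4)] by simp
    then have "finite_dimension E M"
      using telescopic_base_dim(1)[OF E(1) C'(1) _ C'(4)] by simp
    then have "E \<in> \<F>"
      using E C'(3) by (simp add: \<F>_def)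
    then show False
      using C(2)[of E] E(3,4) x(1) by blast
  qed
  then show ?thesis
    using C'(4) by (simp add: M_def)
qed

text \<open>
  Each step from \<open>p\<^sup>n\<close>-th roots to \<open>p\<^bsup>n+1\<^esup>\<close>-th roots adjoins the \<open>p\<close>-th roots of an
  intermediate field, which inherits the chain condition from \<open>L\<close>. The claims besides
  finiteness strengthen the induction.
\<close>

lemma finite_frobenius_roots:
  assumes L: "subfield L R"
    and dcc: "\<And>\<F>. \<F> \<noteq> {} \<Longrightarrow> \<forall>A\<in>\<F>. subfield A R \<and> L \<subseteq> A \<Longrightarrow>
      \<exists>C\<in>\<F>. \<forall>A\<in>\<F>. A \<subseteq> C \<longrightarrow> A = C"
  shows "subfield (frobenius_roots p n L R) R \<and> L \<subseteq> frobenius_roots p n L R \<and>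
    finite_dimension L (frobenius_roots p n L R)"
proof (induction n)
  case 0
  then show ?case
    using L frobenius_roots_0 subringE(1)[OF subfieldE(1)[OF L]] finite_dimensionI[OF dimension_one[OF L]] by simp
next
  case (Suc n)
  define N where "N = frobenius_roots p n L R"
  have N: "subfield N R" "L \<subseteq> N" "finite_dimension L N"
    using Suc by (simp_all add: N_def)
  have N_sub: "N \<subseteq> frobenius_roots p 1 N R"
    using subfield_pow_closed[OF N(1), of _ p] subringE(1)[OF subfieldE(1)[OF N(1)]]
    by (auto simp: frobenius_roots_def)
  have "finite_dimension N (frobenius_roots p 1 N R)"
  proof (rule finite_pth_roots[OF N(1)])
    fix \<F> :: "'a set set"
    assume "\<F> \<noteq> {}" "\<forall>A\<in>\<F>. subfield A R \<and> N \<subseteq> A"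
    then show "\<exists>C\<in>\<F>. \<forall>A\<in>\<F>. A \<subseteq> C \<longrightarrow> A = C"
      using dcc[of \<F>] N(2) by blast
  qed
  then show ?case
    unfolding frobenius_roots_Suc N_def[symmetric]
    using telescopic_base_dim(1)[OF L N(1,3)] frobenius_subfield[OF N(1)] N_sub N(2) by blast
qed

text \<open>
  Finiteness is used over the intersection of the chain only, a field that depends on the
  chain; this is why finiteness over every intermediate field is the right hypothesis in the
  theorem.
\<close>

lemma decreasing_subfields_stationary:
  assumes pins: "purely_inseparable p k R"
    and F: "\<And>i. subfield (F i) R" "\<And>i. k \<subseteq> F i" "decseq F"
    and fin: "finite_dimension (\<Inter>i. F i) (frobenius_roots p 1 (\<Inter>i. F i) R)"
  shows "\<exists>N. F N = (\<Inter>i. F i)"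
proof -
  define D where "D = (\<Inter>i. F i)"
  have D: "subfield D R"
    unfolding D_def by (rule subfield_Inter) (use F(1) in auto)
  define V where "V = frobenius_roots p 1 D R"
  define W where "W i = F i \<inter> V" for i
  have W_sub: "subalgebra D (W i) R" for i
    unfolding W_def
  proof (rule subalgebra_inter)
    show "subalgebra D V R"
      using finite_dimension_imp_subalgebra[OF D] fin by (simp add: V_def D_def)
    show "subalgebra D (F i) R"
      unfolding subalgebra_def subalgebra_axioms_def
      using subring.axioms(1)[OF subfieldE(1)[OF F(1)[of i]]] subringE(6)[OF subfieldE(1)[OF F(1)[of i]]]
      by (auto simp: D_def)
  qed
  have W_fin: "finite_dimension D (W i)" for i
    using subalbegra_incl_imp_finite_dimension[OF D _ W_sub, of V i] fin
    by (simp add: V_def D_def W_def)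
  have "decseq W"
    using F(3) unfolding W_def decseq_def by blast
  then have "\<exists>N. \<forall>i\<ge>N. W i = W N"
    by (rule decreasing_subspaces_stationary[OF D W_fin])
  then obtain N where N: "\<And>i. i \<ge> N \<Longrightarrow> W i = W N"
    by blast
  have W_N: "W N \<subseteq> D"
  proof
    fix z assume z: "z \<in> W N"
    have "z \<in> F i" for i
    proof (cases "i \<ge> N")
      case True
      then show ?thesis using z N[of i] by (auto simp: W_def)
    next
      case False
      then show ?thesis using z decseqD[OF F(3), of i N] by (auto simp: W_def)
    qed
    then show "z \<in> D" by (simp add: D_def)
  qed
  have "y \<in> D" if y: "y \<in> F N" for y
  proof (rule ccontr)
    assume "y \<notin> D"
    have yc: "y \<in> carrier R"
      using y subringE(1)[OF subfieldE(1)[OF F(1)]] by blast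
    then obtain n where "y [^] (p ^ n) \<in> k"
      using pins by (auto simp: purely_inseparable_def)
    then have ex: "y [^] (p ^ n) \<in> D"
      using F(2) by (auto simp: D_def)
    \<comment> \<open>The power of \<open>y\<close> just before the first one in \<open>D\<close> contradicts \<open>W N \<subseteq> D\<close>.\<close>
    define m where "m = (LEAST m. y [^] (p ^ m) \<in> D)"
    have m: "y [^] (p ^ m) \<in> D"
      unfolding m_def using ex by (rule LeastI)
    have "m \<noteq> 0"
      using m \<open>y \<notin> D\<close> yc by (intro notI) simp
    then obtain l where l: "m = Suc l"
      by (cases m) auto
    then have z: "y [^] (p ^ l) \<notin> D"
      using not_less_Least[of l "\<lambda>m. y [^] (p ^ m) \<in> D"] by (simp add: m_def)
    have "(y [^] (p ^ l)) [^] p \<in> D"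
      using m yc by (simp add: l nat_pow_pow mult.commute)
    then have "y [^] (p ^ l) \<in> W N"
      using subfield_pow_closed[OF F(1) y] yc by (simp add: W_def V_def frobenius_roots_def)
    then show False
      using z W_N by blast
  qed
  then show ?thesis
    unfolding D_def[symmetric] by (intro exI[of _ N]) (auto simp: D_def)
qed

end

section \<open>Absolute lq-finiteness and the descending chain condition\<close>

lemma char_p_fieldI:
  assumes "field K" "has_characteristic K p" "p > 0"
  shows "char_p_field K p"
proof -
  interpret field K by fact
  have char: "add_pow K n \<one>\<^bsub>K\<^esub> = \<zero>\<^bsub>K\<^esub> \<longleftrightarrow> p dvd n" for n :: nat
    using assms(2) by (simp add: has_characteristic_def)
  have "p \<noteq> 1"
    using char[of 1] by auto
  have "p dvd a \<or> p dvd b" if "p dvd a * b" for a b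
  proof -
    have "add_pow K a \<one>\<^bsub>K\<^esub> \<otimes>\<^bsub>K\<^esub> add_pow K b \<one>\<^bsub>K\<^esub> = add_pow K (a * b) \<one>\<^bsub>K\<^esub>"
      by (simp add: add_pow_ldistr add.nat_pow_pow mult.commute)
    then show ?thesis
      using char[of "a * b"] char[of a] char[of b] that by (simp add: integral_iff)
  qed
  moreover have "\<not> p dvd 1" "p \<noteq> 0"
    using \<open>p \<noteq> 1\<close> assms(3) by simp_all
  ultimately have "prime_elem p"
    unfolding prime_elem_def by blast
  then have "Factorial_Ring.prime p"
    by simp
  then show ?thesis
    using char[of p] by unfold_locales simp_all
qed

theorem mainTheorem8:
  fixes K :: "('a, 'b) ring_scheme" and k :: "'a set" and p :: nat
  assumes "field K"
    and "has_characteristic K p" and "p > 0"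
    and "subfield k K"
    and "purely_inseparable p k K"
  shows "absolutely_lq_finite p k K \<longleftrightarrow>
    (\<forall>F :: nat \<Rightarrow> 'a set.
       (\<forall>i\<ge>1. intermediate_field k K (F i)) \<longrightarrow>
       (\<forall>i\<ge>1. F (Suc i) \<subseteq> F i) \<longrightarrow>
       (\<exists>N\<ge>1. \<forall>i\<ge>N. F i = F N))" (is "_ \<longleftrightarrow> ?dcc")
proof
  interpret char_p_field K p
    using char_p_fieldI[OF assms(1-3)] .
  show ?dcc if lq: "absolutely_lq_finite p k K"
  proof (intro allI impI)
    fix F :: "nat \<Rightarrow> 'a set"
    assume inter: "\<forall>i\<ge>1. intermediate_field k K (F i)" and dec: "\<forall>i\<ge>1. F (Suc i) \<subseteq> F i"
    define G where "G i = F (Suc i)" for i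
    have G: "subfield (G i) K" "k \<subseteq> G i" for i
      using inter by (auto simp: G_def intermediate_field_def)
    have G_dec: "decseq G"
      using dec by (auto simp: decseq_Suc_iff G_def)
    have "intermediate_field k K (\<Inter>i. G i)"
      unfolding intermediate_field_def using G by (auto intro!: subfield_Inter)
    then have "finite_dimension (\<Inter>i. G i) (frobenius_roots p 1 (\<Inter>i. G i) K)"
      using lq by (simp add: absolutely_lq_finite_def lq_finite_def)
    then obtain N where N: "G N = (\<Inter>i. G i)"
      using decreasing_subfields_stationary[OF assms(5) G G_dec] by blast
    have "G i = G N" if "i \<ge> N" for i
      using N decseqD[OF G_dec that] by blast
    then have "\<forall>i\<ge>Suc N. F i = F (Suc N)"
      unfolding G_def by (metis Suc_le_D Suc_le_mono)
    moreover have "Suc N \<ge> 1"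
      by simp
    ultimately show "\<exists>N\<ge>1. \<forall>i\<ge>N. F i = F N"
      by blast
  qed
  show "absolutely_lq_finite p k K" if dcc: ?dcc
    unfolding absolutely_lq_finite_def lq_finite_def
  proof (intro allI impI)
    fix L and n :: nat
    assume L: "intermediate_field k K L"
    define r where "r = {(A, B). intermediate_field k K A \<and> intermediate_field k K B \<and> A \<subset> B}"
    have wf: "wf r"
      unfolding wf_iff_no_infinite_down_chain
    proof
      assume "\<exists>f. \<forall>i. (f (Suc i), f i) \<in> r"
      then obtain f where "\<forall>i. (f (Suc i), f i) \<in> r" ..
      then have f: "intermediate_field k K (f i)" "f (Suc i) \<subset> f i" for i
        by (simp_all add: r_def)
      then have "\<exists>N\<ge>1. \<forall>i\<ge>N. f i = f N"
        using dcc[rule_format, of f] by blast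
      then obtain N where "\<forall>i\<ge>N. f i = f N"
        by blast
      then have "f (Suc N) = f N"
        using le_SucI[OF order_refl, of N] by blast
      then show False
        using f(2)[of N] by blast
    qed
    have "\<exists>C\<in>\<F>. \<forall>A\<in>\<F>. A \<subseteq> C \<longrightarrow> A = C"
      if ne: "\<F> \<noteq> {}" and sub: "\<forall>A\<in>\<F>. subfield A K \<and> L \<subseteq> A" for \<F>
    proof -
      have int: "intermediate_field k K A" if "A \<in> \<F>" for A
        using that sub L by (auto simp: intermediate_field_def)
      obtain A where "A \<in> \<F>"
        using ne by blast
      then obtain C where C: "C \<in> \<F>" "\<And>A. (A, C) \<in> r \<Longrightarrow> A \<notin> \<F>"
        by (rule wfE_min[OF wf]) blast
      have "A = C" if A: "A \<in> \<F>" "A \<subseteq> C" for A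
      proof (rule ccontr)
        assume "A \<noteq> C"
        then have "(A, C) \<in> r"
          using A int[OF A(1)] int[OF C(1)] by (simp add: r_def psubset_eq)
        then show False
          using C(2) A(1) by blast
      qed
      with C(1) show ?thesis by blast
    qed
    moreover have "subfield L K"
      using L by (simp add: intermediate_field_def)
    ultimately show "finite_dimension L (frobenius_roots p n L K)"
      using finite_frobenius_roots[of L n] by blast
  qed
qed

end
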